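(* Let $R=K[x_1,\dots,x_n]$ be a polynomial ring over a field $K$, and let $I\subset R$ be a principal Borel symmetric strongly shifted ideal with partition Borel generator $\lambda=(\lambda_1,\dots,\lambda_n)$, i.e. $I=\mathrm{Sss}(\{\lambda\})$. Then a primary decomposition (possibly redundant) of $I$ is given by $$I=\bigcap_{j=1}^n\ \bigcap_{\sigma\in\mathfrak S_n}\sigma\big((x_1,\dots,x_j)\big)^{\sum_{i=1}^j\lambda_i}.$$
   Context: $\mathfrak S_n$ acts on $R$ by permuting variables. $P_n=\{\lambda\in\mathbb Z^n: 0\le\lambda_1\le\cdots\le\lambda_n\}$ is the set of partitions (written nondecreasingly), $x^\lambda=x_1^{\lambda_1}\cdots x_n^{\lambda_n}$. For an $\mathfrak S_n$-fixed monomial ideal $I$ put $P(I)=\{\lambda\in P_n: x^\lambda\in I\}$. An $\mathfrak S_n$-fixed monomial ideal $I$ is symmetric strongly shifted if for every $\lambda\in P(I)$ and $1\le i<j\le n$ with $\lambda_i<\lambda_j$ one has $x^\lambda x_i/x_j\in I$. For $B\subseteq P_n$, $\mathrm{Sss}(B)$ is the smallest symmetric strongly shifted ideal containing $\{x^\lambda:\lambda\in B\}$. A principal Borel symmetric strongly shifted ideal is one of the form $\mathrm{Sss}(\{\lambda\})$, $\lambda\in P_n$. All ideals considered are proper (so $\lambda\ne 0$). The zeroth power of an ideal is $R$; such factors are ignored when speaking of a primary decomposition. *)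

theory Defs
  imports
    "HOL-Library.Poly_Mapping"
    "HOL-Combinatorics.Permutations"
    "HOL-Algebra.Ideal_Product"
begin

section \<open>The polynomial ring in the variables \<open>x\<^sub>1, \<dots>, x\<^sub>n\<close>\<close>

text \<open>
  An exponent vector is a finitely supported function \<open>nat \<Rightarrow>\<^sub>0 nat\<close>, and a polynomial is a finitely
  supported function from exponent vectors to coefficients; its multiplication is the convolution
  product of \<^theory>\<open>HOL-Library.Poly_Mapping\<close>. The carrier of \<open>mpoly_ring n\<close> consists of the
  polynomials in which no variable outside \<open>{1..n}\<close> occurs.
\<close>

type_synonym 'k mpoly = "(nat \<Rightarrow>\<^sub>0 nat) \<Rightarrow>\<^sub>0 'k"

definition exponents :: "nat \<Rightarrow> (nat \<Rightarrow>\<^sub>0 nat) set" where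
  "exponents n = {m. Poly_Mapping.keys m \<subseteq> {1..n}}"

definition mpoly_ring :: "nat \<Rightarrow> ('k::field mpoly) ring" where
  "mpoly_ring n =
     \<lparr> carrier = {p. Poly_Mapping.keys p \<subseteq> exponents n},
       monoid.mult = (*), one = 1, zero = 0, add = (+) \<rparr>"

definition xmon :: "(nat \<Rightarrow>\<^sub>0 nat) \<Rightarrow> 'k::field mpoly" where
  "xmon m = Poly_Mapping.single m 1"

definition xvar :: "nat \<Rightarrow> 'k::field mpoly" where
  "xvar i = xmon (Poly_Mapping.single i 1)"

lemma exponents_add: "a \<in> exponents n \<Longrightarrow> b \<in> exponents n \<Longrightarrow> a + b \<in> exponents n"
  unfolding exponents_def using keys_add[of a b] by blast

lemma cring_mpoly_ring: "cring (mpoly_ring n :: 'k::field mpoly ring)"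
proof (rule cringI)
  let ?R = "mpoly_ring n :: 'k mpoly ring"
  show "abelian_group ?R"
  proof (rule abelian_groupI)
    fix x assume x: "x \<in> carrier ?R"
    have "- x \<in> carrier ?R" using x by (auto simp: mpoly_ring_def in_keys_iff)
    then show "\<exists>y\<in>carrier ?R. y \<oplus>\<^bsub>?R\<^esub> x = \<zero>\<^bsub>?R\<^esub>"
      by (intro bexI[of _ "- x"]) (auto simp: mpoly_ring_def)
  next
    fix x y assume "x \<in> carrier ?R" "y \<in> carrier ?R"
    then show "x \<oplus>\<^bsub>?R\<^esub> y \<in> carrier ?R"
      using keys_add[of x y] by (auto simp: mpoly_ring_def)
  qed (auto simp: mpoly_ring_def algebra_simps)
  show "Group.comm_monoid ?R"
  proof (rule comm_monoidI)
    fix x y assume xy: "x \<in> carrier ?R" "y \<in> carrier ?R"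
    have "Poly_Mapping.keys (x * y) \<subseteq> exponents n"
      using keys_mult[of x y] xy exponents_add[of _ n] by (force simp: mpoly_ring_def)
    then show "x \<otimes>\<^bsub>?R\<^esub> y \<in> carrier ?R" by (simp add: mpoly_ring_def)
  qed (auto simp: mpoly_ring_def exponents_def algebra_simps)
qed (auto simp: mpoly_ring_def algebra_simps)


section \<open>The action of the symmetric group\<close>

text \<open>
  The algebra automorphism with \<open>x\<^sub>i \<mapsto> x\<^bsub>\<sigma> i\<^esub>\<close> sends \<open>x\<^sup>m\<close> to the monomial whose exponent at \<open>i\<close> is
  \<open>m (\<sigma>\<^sup>-\<^sup>1 i)\<close>. Only bijective \<open>\<sigma>\<close> are meaningful.
\<close>

definition perm_exp :: "(nat \<Rightarrow> nat) \<Rightarrow> (nat \<Rightarrow>\<^sub>0 nat) \<Rightarrow> (nat \<Rightarrow>\<^sub>0 nat)" where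
  "perm_exp \<sigma> m = Poly_Mapping.map_key (inv_into UNIV \<sigma>) m"

definition perm_poly :: "(nat \<Rightarrow> nat) \<Rightarrow> 'k::field mpoly \<Rightarrow> 'k mpoly" where
  "perm_poly \<sigma> p = (\<Sum>m\<in>Poly_Mapping.keys p. Poly_Mapping.single (perm_exp \<sigma> m) (Poly_Mapping.lookup p m))"

lemma perm_exp_single: "bij \<sigma> \<Longrightarrow> perm_exp \<sigma> (Poly_Mapping.single i k) = Poly_Mapping.single (\<sigma> i) k"
  using Poly_Mapping.map_key_single[of "inv_into UNIV \<sigma>" "\<sigma> i" k]
  by (simp add: perm_exp_def bij_imp_bij_inv bij_is_inj)

lemma perm_poly_xvar: "bij \<sigma> \<Longrightarrow> perm_poly \<sigma> (xvar i :: 'k::field mpoly) = xvar (\<sigma> i)"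
  by (simp add: perm_poly_def xvar_def xmon_def perm_exp_single)


section \<open>Symmetric strongly shifted ideals\<close>

definition partitions :: "nat \<Rightarrow> (nat \<Rightarrow>\<^sub>0 nat) set" where
  "partitions n =
     {l \<in> exponents n. \<forall>i j. 1 \<le> i \<longrightarrow> i \<le> j \<longrightarrow> j \<le> n \<longrightarrow> Poly_Mapping.lookup l i \<le> Poly_Mapping.lookup l j}"

definition monomial_ideal :: "nat \<Rightarrow> 'k::field mpoly set \<Rightarrow> bool" where
  "monomial_ideal n I \<longleftrightarrow> (\<exists>M \<subseteq> exponents n. I = Idl\<^bsub>mpoly_ring n\<^esub> (xmon ` M))"

definition sym_fixed :: "nat \<Rightarrow> 'k::field mpoly set \<Rightarrow> bool" where
  "sym_fixed n I \<longleftrightarrow> (\<forall>\<sigma>. \<sigma> permutes {1..n} \<longrightarrow> perm_poly \<sigma> ` I = I)"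

definition partitions_of :: "nat \<Rightarrow> 'k::field mpoly set \<Rightarrow> (nat \<Rightarrow>\<^sub>0 nat) set" where
  "partitions_of n I = {l \<in> partitions n. xmon l \<in> I}"

text \<open>
  Below, \<open>l + e\<^sub>i - e\<^sub>j\<close> is the exponent vector of \<open>x\<^sup>l x\<^sub>i / x\<^sub>j\<close>; the truncated subtraction is harmless
  since \<open>l\<^sub>i < l\<^sub>j\<close> forces \<open>l\<^sub>j > 0\<close>.
\<close>

definition sym_strongly_shifted :: "nat \<Rightarrow> 'k::field mpoly set \<Rightarrow> bool" where
  "sym_strongly_shifted n I \<longleftrightarrow>
     monomial_ideal n I \<and> sym_fixed n I \<and>
     (\<forall>l \<in> partitions_of n I. \<forall>i j. 1 \<le> i \<longrightarrow> i < j \<longrightarrow> j \<le> n \<longrightarrow>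
        Poly_Mapping.lookup l i < Poly_Mapping.lookup l j \<longrightarrow>
        xmon (l + Poly_Mapping.single i 1 - Poly_Mapping.single j 1) \<in> I)"

definition Sss :: "nat \<Rightarrow> (nat \<Rightarrow>\<^sub>0 nat) set \<Rightarrow> 'k::field mpoly set" where
  "Sss n B = \<Inter>{I. sym_strongly_shifted n I \<and> xmon ` B \<subseteq> I}"


text \<open>The intersection defining \<open>Sss\<close> is indeed the smallest symmetric strongly shifted ideal containing the given monomials.\<close>

lemma perm_exp_inv: "bij \<sigma> \<Longrightarrow> perm_exp \<sigma> (perm_exp (inv_into UNIV \<sigma>) m) = m"
  by (simp add: perm_exp_def Poly_Mapping.map_key_compose bij_imp_bij_inv bij_is_inj inv_inv_eq
      bij_is_surj o_def surj_f_inv_f Poly_Mapping.map_key_id)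

lemma perm_exp_inv': "bij \<sigma> \<Longrightarrow> perm_exp (inv_into UNIV \<sigma>) (perm_exp \<sigma> m) = m"
  using perm_exp_inv[of "inv_into UNIV \<sigma>" m] by (simp add: bij_imp_bij_inv inv_inv_eq)

lemma lookup_perm_poly:
  assumes "bij \<sigma>"
  shows "Poly_Mapping.lookup (perm_poly \<sigma> p) m = Poly_Mapping.lookup p (perm_exp (inv_into UNIV \<sigma>) m)"
proof -
  have eq: "perm_exp \<sigma> a = m \<longleftrightarrow> a = perm_exp (inv_into UNIV \<sigma>) m" for a
    using perm_exp_inv[OF assms] perm_exp_inv'[OF assms] by metis
  show ?thesis
    by (auto simp: perm_poly_def lookup_sum lookup_single when_def eq in_keys_iff)
qed

lemma perm_poly_inv: "bij \<sigma> \<Longrightarrow> perm_poly \<sigma> (perm_poly (inv_into UNIV \<sigma>) p) = p"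
  by (rule poly_mapping_eqI)
    (simp add: lookup_perm_poly bij_imp_bij_inv inv_inv_eq perm_exp_inv)

lemma monomial_ideal_iff:
  fixes I :: "'k::field mpoly set"
  shows "monomial_ideal n I \<longleftrightarrow>
     ideal I (mpoly_ring n) \<and>
     (\<forall>p\<in>I. \<forall>m\<in>Poly_Mapping.keys p. xmon m \<in> I)" (is "?A \<longleftrightarrow> ?B")
proof
  let ?R = "mpoly_ring n :: 'k mpoly ring"
  interpret cring ?R by (rule cring_mpoly_ring)
  show ?B if ?A
  proof -
    from that obtain M where M: "M \<subseteq> exponents n" and I: "I = Idl\<^bsub>?R\<^esub> (xmon ` M)"
      by (auto simp: monomial_ideal_def)
    have sub: "xmon ` M \<subseteq> carrier ?R" using M by (auto simp: mpoly_ring_def xmon_def)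
    have idI: "ideal I ?R" unfolding I by (rule genideal_ideal[OF sub])
    let ?S = "{m. \<exists>a\<in>M. \<exists>c\<in>exponents n. m = a + c}"
    let ?J = "{p :: 'k mpoly. Poly_Mapping.keys p \<subseteq> ?S}"
    have S: "?S \<subseteq> exponents n" using M exponents_add by auto
    have idJ: "ideal ?J ?R"
    proof (rule idealI)
      show "subgroup ?J (add_monoid ?R)"
      proof (rule group.subgroupI)
        show "Group.group (add_monoid ?R)" using add.is_group .
        show "?J \<subseteq> carrier (add_monoid ?R)" using S by (auto simp: mpoly_ring_def)
        show "?J \<noteq> {}" by (auto intro: exI[of _ 0])
        fix a assume a: "a \<in> ?J"
        have ac: "a \<in> carrier ?R" using a S by (auto simp: mpoly_ring_def)
        have "\<ominus>\<^bsub>?R\<^esub> a = - a"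
          using ac by (intro minus_equality) (auto simp: mpoly_ring_def)
        then show "inv\<^bsub>add_monoid ?R\<^esub> a \<in> ?J" using a by (simp add: a_inv_def)
      next
        fix a b assume "a \<in> ?J" "b \<in> ?J"
        then show "a \<otimes>\<^bsub>add_monoid ?R\<^esub> b \<in> ?J"
          using keys_add[of a b] by (auto simp: mpoly_ring_def)
      qed
    next
      fix a x assume a: "a \<in> ?J" and x: "x \<in> carrier ?R"
      have "Poly_Mapping.keys (x * a) \<subseteq> ?S"
      proof
        fix m assume "m \<in> Poly_Mapping.keys (x * a)"
        then obtain u v where m: "m = u + v" and u: "u \<in> Poly_Mapping.keys x"
          and v: "v \<in> Poly_Mapping.keys a" using keys_mult[of x a] by blast
        from v a obtain b c where "b \<in> M" "c \<in> exponents n" "v = b + c" by blast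
        moreover have "u \<in> exponents n" using u x by (auto simp: mpoly_ring_def)
        moreover from calculation have "u + c \<in> exponents n" "m = b + (u + c)"
          using m by (auto intro: exponents_add simp: algebra_simps)
        ultimately show "m \<in> ?S" by blast
      qed
      then show "x \<otimes>\<^bsub>?R\<^esub> a \<in> ?J" and "a \<otimes>\<^bsub>?R\<^esub> x \<in> ?J"
        by (auto simp: mpoly_ring_def mult.commute)
    qed (rule ring_axioms)
    have "xmon ` M \<subseteq> ?J"
      by (force simp: xmon_def exponents_def intro: bexI[of _ 0])
    then have IJ: "I \<subseteq> ?J" unfolding I by (rule genideal_minimal[OF idJ])
    have "xmon m \<in> I" if "p \<in> I" "m \<in> Poly_Mapping.keys p" for p m
    proof -
      from that IJ obtain a c where ac: "a \<in> M" "c \<in> exponents n" "m = a + c" by blast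
      have "xmon a \<in> I" unfolding I using genideal_self[OF sub] ac by blast
      moreover have "xmon c \<in> carrier ?R" using ac by (auto simp: mpoly_ring_def xmon_def)
      ultimately have "xmon a \<otimes>\<^bsub>?R\<^esub> xmon c \<in> I" by (rule ideal.I_r_closed[OF idI])
      then show ?thesis using ac by (simp add: mpoly_ring_def xmon_def mult_single)
    qed
    with idI show ?B by blast
  qed
  show ?A if B: ?B
  proof -
    let ?M = "{m \<in> exponents n. (xmon m :: 'k mpoly) \<in> I}"
    from B have idI: "ideal I ?R" by blast
    have sub: "xmon ` ?M \<subseteq> carrier ?R" by (auto simp: mpoly_ring_def xmon_def)
    have idM: "ideal (Idl\<^bsub>?R\<^esub> (xmon ` ?M)) ?R" by (rule genideal_ideal[OF sub])
    have "p \<in> Idl\<^bsub>?R\<^esub> (xmon ` ?M)" if p: "p \<in> I" for p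
    proof -
      have pc: "p \<in> carrier ?R" using p idI by (rule ideal.Icarr[rotated])
      have summand: "Poly_Mapping.single m (Poly_Mapping.lookup p m) \<in> Idl\<^bsub>?R\<^esub> (xmon ` ?M)"
        if m: "m \<in> Poly_Mapping.keys p" for m
      proof -
        have "m \<in> ?M" using m p B pc by (auto simp: mpoly_ring_def)
        then have "xmon m \<in> Idl\<^bsub>?R\<^esub> (xmon ` ?M)" using genideal_self[OF sub] by blast
        moreover have "Poly_Mapping.single 0 (Poly_Mapping.lookup p m) \<in> carrier ?R"
          by (auto simp: mpoly_ring_def exponents_def)
        ultimately have "xmon m \<otimes>\<^bsub>?R\<^esub> Poly_Mapping.single 0 (Poly_Mapping.lookup p m)
            \<in> Idl\<^bsub>?R\<^esub> (xmon ` ?M)"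
          by (rule ideal.I_r_closed[OF idM])
        then show ?thesis by (simp add: mpoly_ring_def xmon_def mult_single)
      qed
      have add: "a + b \<in> Idl\<^bsub>?R\<^esub> (xmon ` ?M)"
        if "a \<in> Idl\<^bsub>?R\<^esub> (xmon ` ?M)" "b \<in> Idl\<^bsub>?R\<^esub> (xmon ` ?M)" for a b
        using additive_subgroup.a_closed[OF ideal.axioms(1)[OF idM] that] by (simp add: mpoly_ring_def)
      have zero: "0 \<in> Idl\<^bsub>?R\<^esub> (xmon ` ?M)"
        using additive_subgroup.zero_closed[OF ideal.axioms(1)[OF idM]] by (simp add: mpoly_ring_def)
      have "(\<Sum>m\<in>T. Poly_Mapping.single m (Poly_Mapping.lookup p m)) \<in> Idl\<^bsub>?R\<^esub> (xmon ` ?M)"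
        if "finite T" "T \<subseteq> Poly_Mapping.keys p" for T
        using that by (induction T rule: finite_induct) (auto intro: add zero summand)
      from this[of "Poly_Mapping.keys p"]
      have "(\<Sum>m\<in>Poly_Mapping.keys p. Poly_Mapping.single m (Poly_Mapping.lookup p m))
          \<in> Idl\<^bsub>?R\<^esub> (xmon ` ?M)" by simp
      also have "(\<Sum>m\<in>Poly_Mapping.keys p. Poly_Mapping.single m (Poly_Mapping.lookup p m)) = p"
        by (rule poly_mapping_eqI) (auto simp: lookup_sum lookup_single when_def in_keys_iff)
      finally show ?thesis .
    qed
    moreover have "Idl\<^bsub>?R\<^esub> (xmon ` ?M) \<subseteq> I" by (rule genideal_minimal[OF idI]) auto
    ultimately show ?A unfolding monomial_ideal_def by (intro exI[of _ ?M]) auto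
  qed
qed

lemma sym_strongly_shifted_carrier:
  "sym_strongly_shifted n (carrier (mpoly_ring n :: 'k::field mpoly ring))"
proof -
  let ?R = "mpoly_ring n :: 'k mpoly ring"
  interpret cring ?R by (rule cring_mpoly_ring)
  have exp: "perm_exp \<tau> m \<in> exponents n" if "\<tau> permutes {1..n}" "m \<in> exponents n" for \<tau> m
  proof -
    have "inj (inv_into UNIV \<tau>)" by (rule permutes_inj[OF permutes_inv[OF that(1)]])
    then show ?thesis
      using that permutes_in_image[OF permutes_inv[OF that(1)]]
      by (auto simp: perm_exp_def exponents_def Poly_Mapping.keys_map_key)
  qed
  have closed: "perm_poly \<tau> p \<in> carrier ?R" if t: "\<tau> permutes {1..n}" and p: "p \<in> carrier ?R" for \<tau> p
  proof -
    have "m \<in> exponents n" if "m \<in> Poly_Mapping.keys (perm_poly \<tau> p)" for m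
    proof -
      have "perm_exp (inv_into UNIV \<tau>) m \<in> exponents n"
        using that p permutes_bij[OF t] by (auto simp: in_keys_iff lookup_perm_poly mpoly_ring_def)
      from exp[OF t this] show ?thesis by (simp add: perm_exp_inv permutes_bij[OF t])
    qed
    then show ?thesis by (auto simp: mpoly_ring_def)
  qed
  have "sym_fixed n (carrier ?R)"
    unfolding sym_fixed_def
  proof (intro allI impI equalityI subsetI)
    fix \<sigma> p assume s: "\<sigma> permutes {1..n}"
    show "p \<in> carrier ?R" if "p \<in> perm_poly \<sigma> ` carrier ?R" using that closed[OF s] by blast
    show "p \<in> perm_poly \<sigma> ` carrier ?R" if "p \<in> carrier ?R"
      using closed[OF permutes_inv[OF s] that] perm_poly_inv[OF permutes_bij[OF s], of p]
      by (metis imageI)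
  qed
  moreover have "monomial_ideal n (carrier ?R)"
    unfolding monomial_ideal_iff using oneideal by (auto simp: mpoly_ring_def xmon_def)
  moreover have "xmon (l + Poly_Mapping.single i 1 - Poly_Mapping.single j 1) \<in> carrier ?R"
    if "l \<in> partitions n" "1 \<le> i" "i < j" "j \<le> n" for l i j
  proof -
    have "Poly_Mapping.keys l \<subseteq> {1..n}" using that by (simp add: partitions_def exponents_def)
    then have "x \<in> {1..n}" if "Poly_Mapping.lookup l x \<noteq> 0" for x
      using that by (auto simp: in_keys_iff simp del: atLeastAtMost_iff)
    then have "Poly_Mapping.keys (l + Poly_Mapping.single i 1 - Poly_Mapping.single j 1) \<subseteq> {1..n}"
      using that by (force simp: in_keys_iff lookup_add lookup_minus lookup_single when_def split: if_splits)
    then show ?thesis by (simp add: mpoly_ring_def xmon_def exponents_def)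
  qed
  ultimately show ?thesis by (auto simp: sym_strongly_shifted_def partitions_of_def)
qed

lemma Sss_least:
  assumes "B \<subseteq> partitions n"
  shows "sym_strongly_shifted n (Sss n B :: 'k::field mpoly set)"
    and "xmon ` B \<subseteq> (Sss n B :: 'k mpoly set)"
    and "\<And>I. sym_strongly_shifted n I \<Longrightarrow> xmon ` B \<subseteq> I \<Longrightarrow> (Sss n B :: 'k mpoly set) \<subseteq> I"
proof -
  let ?R = "mpoly_ring n :: 'k mpoly ring"
  let ?F = "{I :: 'k mpoly set. sym_strongly_shifted n I \<and> xmon ` B \<subseteq> I}"
  interpret cring ?R by (rule cring_mpoly_ring)
  show "xmon ` B \<subseteq> (Sss n B :: 'k mpoly set)" by (auto simp: Sss_def)
  show "(Sss n B :: 'k mpoly set) \<subseteq> I" if "sym_strongly_shifted n I" "xmon ` B \<subseteq> I" for I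
    using that by (auto simp: Sss_def)
  have "carrier ?R \<in> ?F"
    using assms sym_strongly_shifted_carrier by (auto simp: partitions_def mpoly_ring_def xmon_def)
  then have ne: "?F \<noteq> {}" by blast
  have "ideal (\<Inter>?F) ?R"
    by (rule i_Intersect[OF _ ne]) (auto simp: sym_strongly_shifted_def monomial_ideal_iff)
  then have "monomial_ideal n (\<Inter>?F)"
    by (auto simp: monomial_ideal_iff sym_strongly_shifted_def)
  moreover have "sym_fixed n (\<Inter>?F)"
    unfolding sym_fixed_def
  proof (intro allI impI equalityI subsetI)
    fix \<sigma> and p :: "'k mpoly" assume s: "\<sigma> permutes {1..n}"
    have img: "perm_poly \<tau> q \<in> \<Inter>?F" if "\<tau> permutes {1..n}" "q \<in> \<Inter>?F" for \<tau> q
      using that unfolding sym_strongly_shifted_def sym_fixed_def by blast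
    show "p \<in> \<Inter>?F" if "p \<in> perm_poly \<sigma> ` \<Inter>?F" using that img[OF s] by blast
    show "p \<in> perm_poly \<sigma> ` \<Inter>?F" if "p \<in> \<Inter>?F"
      using img[OF permutes_inv[OF s] that] perm_poly_inv[OF permutes_bij[OF s], of p]
      by (metis imageI)
  qed
  ultimately show "sym_strongly_shifted n (Sss n B :: 'k mpoly set)"
    unfolding Sss_def sym_strongly_shifted_def partitions_of_def by blast
qed


section \<open>Primary decompositions\<close>

definition primary_ideal :: "('a, 'b) ring_scheme \<Rightarrow> 'a set \<Rightarrow> bool" where
  "primary_ideal R Q \<longleftrightarrow>
     ideal Q R \<and> Q \<noteq> carrier R \<and>
     (\<forall>a\<in>carrier R. \<forall>b\<in>carrier R. a \<otimes>\<^bsub>R\<^esub> b \<in> Q \<longrightarrow> a \<in> Q \<or> (\<exists>k::nat. 0 < k \<and> b [^]\<^bsub>R\<^esub> k \<in> Q))"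

text \<open>Redundant and repeated components are allowed.\<close>

definition primary_decomposition ::
  "('a, 'b) ring_scheme \<Rightarrow> 'a set \<Rightarrow> 'i set \<Rightarrow> ('i \<Rightarrow> 'a set) \<Rightarrow> bool" where
  "primary_decomposition R I A Q \<longleftrightarrow>
     finite A \<and> (\<forall>a\<in>A. primary_ideal R (Q a)) \<and> I = carrier R \<inter> (\<Inter>a\<in>A. Q a)"

definition ideal_power :: "('a, 'b) ring_scheme \<Rightarrow> 'a set \<Rightarrow> nat \<Rightarrow> 'a set" where
  "ideal_power R J k = J [^]\<^bsub>ideals_set R\<^esub> k"

definition perm_var_ideal :: "nat \<Rightarrow> nat \<Rightarrow> (nat \<Rightarrow> nat) \<Rightarrow> 'k::field mpoly set" where
  "perm_var_ideal n j \<sigma> = perm_poly \<sigma> ` (Idl\<^bsub>mpoly_ring n\<^esub> (xvar ` {1..j}))"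

end

theory Submission
  imports Defs
begin

text \<open>
  For a set \<open>S\<close> of variables, the \<open>k\<close>-th power of the prime \<open>(x\<^sub>i : i \<in> S)\<close> consists of the polynomials
  all of whose monomials have degree at least \<open>k\<close> in the variables of \<open>S\<close>. It is primary because the
  lowest forms with respect to this degree multiply. Hence the monomials \<open>x\<^sup>m\<close> in the intersection
  are those for which every \<open>j\<close> entries of \<open>m\<close> add up to at least the sum of the \<open>j\<close> smallest
  entries of the partition \<open>l\<close>. This condition is preserved by the shifts, so the intersection
  contains \<open>Sss {l}\<close>. Conversely, a sorted \<open>m\<close> satisfying it is obtained from \<open>l\<close> by multiplications
  with \<open>x\<^sub>n\<close> and by shifts, as in the Hardy--Littlewood--Polya theorem on majorization.
\<close>

section \<open>Polynomials supported in an up-closed set of exponents\<close>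

text \<open>For an up-closed \<open>U\<close> inside \<open>exponents n\<close> this is the monomial
  ideal with monomials \<open>U\<close>, given as a linear span instead of by generators, so that
  membership becomes a condition on exponents alone.\<close>

definition supported_in :: "(nat \<Rightarrow>\<^sub>0 nat) set \<Rightarrow> 'k::field mpoly set" where
  "supported_in U = {p. Poly_Mapping.keys p \<subseteq> U}"

lemma xmon_in_supported_in [simp]: "(xmon m :: 'k::field mpoly) \<in> supported_in U \<longleftrightarrow> m \<in> U"
  by (simp add: supported_in_def xmon_def)

lemma supported_in_exponents: "supported_in (exponents n) = carrier (mpoly_ring n)"
  by (simp add: supported_in_def mpoly_ring_def)

text \<open>Every monomial of a product is a product of monomials of the factors, so up-closure of
  \<open>U\<close> gives closure under multiplication by ring elements.\<close>

lemma ideal_supported_in: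
  assumes U: "U \<subseteq> exponents n" and up: "\<And>m c. m \<in> U \<Longrightarrow> c \<in> exponents n \<Longrightarrow> m + c \<in> U"
  shows "ideal (supported_in U :: 'k::field mpoly set) (mpoly_ring n)"
proof -
  let ?R = "mpoly_ring n :: 'k mpoly ring"
  interpret cring ?R by (rule cring_mpoly_ring)
  show ?thesis
  proof (rule idealI)
    show "subgroup (supported_in U) (add_monoid ?R)"
    proof (rule group.subgroupI)
      show "Group.group (add_monoid ?R)" using add.is_group .
      show "supported_in U \<subseteq> carrier (add_monoid ?R)"
        using U by (auto simp: mpoly_ring_def supported_in_def)
      show "(supported_in U :: 'k mpoly set) \<noteq> {}"
        by (auto simp: supported_in_def intro: exI[of _ 0])
      fix a :: "'k mpoly" assume a: "a \<in> supported_in U"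
      have "a \<in> carrier ?R" using a U by (auto simp: mpoly_ring_def supported_in_def)
      then have "\<ominus>\<^bsub>?R\<^esub> a = - a"
        by (intro minus_equality) (auto simp: mpoly_ring_def)
      then show "inv\<^bsub>add_monoid ?R\<^esub> a \<in> supported_in U"
        using a by (simp add: a_inv_def supported_in_def)
    next
      fix a b :: "'k mpoly" assume "a \<in> supported_in U" "b \<in> supported_in U"
      then show "a \<otimes>\<^bsub>add_monoid ?R\<^esub> b \<in> supported_in U"
        using keys_add[of a b] by (auto simp: mpoly_ring_def supported_in_def)
    qed
  next
    fix a x :: "'k mpoly" assume a: "a \<in> supported_in U" and x: "x \<in> carrier ?R"
    have "Poly_Mapping.keys (a * x) \<subseteq> U"
    proof
      fix m assume "m \<in> Poly_Mapping.keys (a * x)"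
      then obtain u v where "m = u + v" "u \<in> Poly_Mapping.keys a" "v \<in> Poly_Mapping.keys x"
        using keys_mult[of a x] by blast
      then show "m \<in> U" using a x up by (auto simp: mpoly_ring_def supported_in_def)
    qed
    then show "x \<otimes>\<^bsub>?R\<^esub> a \<in> supported_in U" and "a \<otimes>\<^bsub>?R\<^esub> x \<in> supported_in U"
      by (auto simp: mpoly_ring_def supported_in_def mult.commute)
  qed (rule ring_axioms)
qed

text \<open>A polynomial is the finite sum of its terms, so additive properties need checking on
  single terms only.\<close>

lemma supported_in_induct [consumes 1, case_names zero add single]:
  fixes p :: "'k::field mpoly"
  assumes p: "p \<in> supported_in U"
    and zero: "P 0"
    and add: "\<And>a b. P a \<Longrightarrow> P b \<Longrightarrow> P (a + b)"
    and single: "\<And>m c. m \<in> U \<Longrightarrow> P (Poly_Mapping.single m c)"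
  shows "P p"
proof -
  have "P (\<Sum>m\<in>T. Poly_Mapping.single m (Poly_Mapping.lookup p m))"
    if "finite T" "T \<subseteq> Poly_Mapping.keys p" for T
    using that p by (induction T rule: finite_induct) (auto intro: zero add single simp: supported_in_def)
  from this[of "Poly_Mapping.keys p"]
  have "P (\<Sum>m\<in>Poly_Mapping.keys p. Poly_Mapping.single m (Poly_Mapping.lookup p m))" by simp
  also have "(\<Sum>m\<in>Poly_Mapping.keys p. Poly_Mapping.single m (Poly_Mapping.lookup p m)) = p"
    by (rule poly_mapping_eqI) (auto simp: lookup_sum lookup_single when_def in_keys_iff)
  finally show ?thesis .
qed

lemma ideal_mpoly_closed:
  fixes J :: "'k::field mpoly set"
  assumes "ideal J (mpoly_ring n)"
  shows "0 \<in> J"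
    and "a \<in> J \<Longrightarrow> b \<in> J \<Longrightarrow> a + b \<in> J"
    and "a \<in> J \<Longrightarrow> x \<in> carrier (mpoly_ring n) \<Longrightarrow> a * x \<in> J"
  using additive_subgroup.zero_closed[OF ideal.axioms(1)[OF assms]]
    additive_subgroup.a_closed[OF ideal.axioms(1)[OF assms], of a b]
    ideal.I_r_closed[OF assms, of a x]
  by (simp_all add: mpoly_ring_def)

lemma supported_in_subset_ideal:
  fixes J :: "'k::field mpoly set"
  assumes J: "ideal J (mpoly_ring n)" and "\<And>m. m \<in> U \<Longrightarrow> xmon m \<in> J"
  shows "supported_in U \<subseteq> J"
proof
  fix p :: "'k mpoly" assume "p \<in> supported_in U"
  then show "p \<in> J"
  proof (induction rule: supported_in_induct)
    case (single m c)
    \<comment> \<open>The coefficient is restored by multiplying \<open>xmon m\<close> with the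
      constant polynomial \<open>c\<close>.\<close>
    have "(Poly_Mapping.single 0 c :: 'k mpoly) \<in> carrier (mpoly_ring n)"
      by (auto simp: mpoly_ring_def exponents_def)
    from ideal_mpoly_closed(3)[OF J assms(2)[OF single] this] show ?case
      by (simp add: xmon_def mult_single)
  qed (auto intro: ideal_mpoly_closed[OF J])
qed

lemma monomial_ideal_supported_in:
  assumes "U \<subseteq> exponents n" "\<And>m c. m \<in> U \<Longrightarrow> c \<in> exponents n \<Longrightarrow> m + c \<in> U"
  shows "monomial_ideal n (supported_in U :: 'k::field mpoly set)"
  unfolding monomial_ideal_iff using ideal_supported_in[OF assms]
  by (auto simp: supported_in_def xmon_def)


section \<open>Powers of monomial primes\<close>

definition var_order :: "nat set \<Rightarrow> (nat \<Rightarrow>\<^sub>0 nat) \<Rightarrow> nat" where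
  "var_order S m = (\<Sum>i\<in>S. Poly_Mapping.lookup m i)"

definition order_ge :: "nat \<Rightarrow> nat set \<Rightarrow> nat \<Rightarrow> 'k::field mpoly set" where
  "order_ge n S k = supported_in {m \<in> exponents n. k \<le> var_order S m}"

lemma var_order_add: "var_order S (a + b) = var_order S a + var_order S b"
  by (simp add: var_order_def lookup_add sum.distrib)

lemma ideal_order_ge: "ideal (order_ge n S k) (mpoly_ring n)"
  unfolding order_ge_def by (rule ideal_supported_in) (auto simp: var_order_add exponents_add)

lemma order_ge_0: "order_ge n S 0 = carrier (mpoly_ring n)"
  by (simp add: order_ge_def supported_in_exponents)

lemma order_ge_mult:
  "a \<in> order_ge n S k \<Longrightarrow> b \<in> order_ge n S k' \<Longrightarrow> a * b \<in> order_ge n S (k + k')"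
  using keys_mult[of a b] exponents_add
  by (fastforce simp: order_ge_def supported_in_def var_order_add)

text \<open>Peels one variable of \<open>S\<close> off a monomial; this serves both the ideal
  generated by the variables and the induction on its powers.\<close>

lemma exponent_split_var:
  assumes "m \<in> exponents n" "finite S" "Suc k \<le> var_order S m"
  obtains i m' where "i \<in> S" "i \<in> {1..n}" "m' \<in> exponents n" "m = m' + Poly_Mapping.single i 1"
    "k \<le> var_order S m'"
proof -
  from assms have "\<exists>i\<in>S. Poly_Mapping.lookup m i \<noteq> 0"
    unfolding var_order_def by (metis Suc_le_D nat.simps(3) sum.neutral)
  then obtain i where i: "i \<in> S" "Poly_Mapping.lookup m i \<noteq> 0" by blast
  define m' where "m' = m - Poly_Mapping.single i 1"
  have m: "m = m' + Poly_Mapping.single i 1"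
    using i by (intro poly_mapping_eqI) (auto simp: m'_def lookup_add lookup_minus lookup_single when_def)
  have "i \<in> {1..n}" using i assms(1) unfolding exponents_def in_keys_iff[symmetric] by blast
  moreover have "m' \<in> exponents n"
    using assms(1) unfolding m'_def exponents_def
    by (auto simp: subset_iff in_keys_iff lookup_minus simp del: atLeastAtMost_iff)
  moreover have "var_order S (Poly_Mapping.single i 1) = 1"
    using i assms(2) by (simp add: var_order_def lookup_single when_def)
  then have "k \<le> var_order S m'" using assms(3) by (simp add: m var_order_add)
  ultimately show ?thesis using that i(1) m by blast
qed

lemma genideal_xvar:
  assumes "S \<subseteq> {1..n}"
  shows "Idl\<^bsub>mpoly_ring n\<^esub> (xvar ` S) = (order_ge n S 1 :: 'k::field mpoly set)"
proof
  let ?R = "mpoly_ring n :: 'k mpoly ring"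
  interpret cring ?R by (rule cring_mpoly_ring)
  have fin: "finite S" using assms finite_subset by blast
  have single: "Poly_Mapping.single i 1 \<in> exponents n" if "i \<in> S" for i
    using that assms by (auto simp: exponents_def)
  have sub: "xvar ` S \<subseteq> carrier ?R"
    using single by (auto simp: mpoly_ring_def xvar_def xmon_def)
  show "Idl\<^bsub>?R\<^esub> (xvar ` S) \<subseteq> order_ge n S 1"
  proof (rule genideal_minimal[OF ideal_order_ge])
    show "xvar ` S \<subseteq> (order_ge n S 1 :: 'k mpoly set)"
      using single fin by (auto simp: order_ge_def xvar_def var_order_def lookup_single when_def)
  qed
  show "order_ge n S 1 \<subseteq> Idl\<^bsub>?R\<^esub> (xvar ` S)"
    unfolding order_ge_def
  proof (rule supported_in_subset_ideal[OF genideal_ideal[OF sub]])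
    fix m assume "m \<in> {m \<in> exponents n. 1 \<le> var_order S m}"
    then have m: "m \<in> exponents n" "Suc 0 \<le> var_order S m" by auto
    obtain i m' where i: "i \<in> S" "m' \<in> exponents n" "m = m' + Poly_Mapping.single i 1"
      using exponent_split_var[OF m(1) fin m(2)] by blast
    have "(xvar i :: 'k mpoly) \<in> Idl\<^bsub>?R\<^esub> (xvar ` S)" using genideal_self[OF sub] i by blast
    moreover have "(xmon m' :: 'k mpoly) \<in> carrier ?R" using i by (simp add: mpoly_ring_def xmon_def)
    ultimately have "xvar i * xmon m' \<in> Idl\<^bsub>?R\<^esub> (xvar ` S)"
      by (rule ideal_mpoly_closed(3)[OF genideal_ideal[OF sub]])
    then show "xmon m \<in> Idl\<^bsub>?R\<^esub> (xvar ` S)"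
      using i by (simp add: xvar_def xmon_def mult_single add.commute)
  qed
qed

text \<open>Induction on \<open>k\<close>: degrees in \<open>S\<close> add under multiplication, and
  a term of degree at least \<open>Suc k\<close> is a term of degree at least \<open>k\<close> times
  a variable of \<open>S\<close>.\<close>

lemma ideal_power_order_ge:
  assumes "finite S"
  shows "ideal_power (mpoly_ring n) (order_ge n S 1 :: 'k::field mpoly set) k = order_ge n S k"
proof (induction k)
  case 0
  then show ?case by (simp add: ideal_power_def ideals_set_def order_ge_0)
next
  case (Suc k)
  let ?R = "mpoly_ring n :: 'k mpoly ring"
  have "ideal_prod ?R (order_ge n S k) (order_ge n S 1) = order_ge n S (Suc k)"
  proof (intro equalityI subsetI)
    fix p :: "'k mpoly" assume "p \<in> ideal_prod ?R (order_ge n S k) (order_ge n S 1)"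
    then show "p \<in> order_ge n S (Suc k)"
    proof (induction rule: ideal_prod.induct)
      case (prod a b)
      then show ?case using order_ge_mult[of a n S k b 1] by (simp add: mpoly_ring_def)
    next
      case (sum a b)
      then show ?case using ideal_mpoly_closed(2)[OF ideal_order_ge] by (simp add: mpoly_ring_def)
    qed
  next
    fix p :: "'k mpoly" assume "p \<in> order_ge n S (Suc k)"
    then show "p \<in> ideal_prod ?R (order_ge n S k) (order_ge n S 1)"
      unfolding order_ge_def[of n S "Suc k"]
    proof (induction rule: supported_in_induct)
      case zero
      \<comment> \<open>Members of \<open>ideal_prod\<close> arise from products by addition only,
        so \<open>0\<close> must be exhibited as a product.\<close>
      have "0 \<otimes>\<^bsub>?R\<^esub> 0 \<in> ideal_prod ?R (order_ge n S k) (order_ge n S 1)"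
        by (intro ideal_prod.prod ideal_mpoly_closed(1)[OF ideal_order_ge])
      then show ?case by (simp add: mpoly_ring_def)
    next
      case (add a b)
      then show ?case using ideal_prod.sum[of a ?R _ _ b] by (simp add: mpoly_ring_def)
    next
      case (single m c)
      then obtain i m' where i: "i \<in> S" "i \<in> {1..n}" "m' \<in> exponents n"
        "m = m' + Poly_Mapping.single i 1" "k \<le> var_order S m'"
        using exponent_split_var[OF _ assms, of m n k] by auto
      have "Poly_Mapping.single m' c \<in> order_ge n S k"
        using i by (auto simp: order_ge_def supported_in_def)
      moreover have "(xvar i :: 'k mpoly) \<in> order_ge n S 1"
        using i assms
        by (auto simp: order_ge_def xvar_def var_order_def lookup_single when_def exponents_def)
      ultimately have "Poly_Mapping.single m' c \<otimes>\<^bsub>?R\<^esub> xvar i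
          \<in> ideal_prod ?R (order_ge n S k) (order_ge n S 1)"
        by (rule ideal_prod.prod)
      then show ?case
        by (simp add: i(4) mpoly_ring_def xvar_def xmon_def mult_single)
    qed
  qed
  with Suc show ?case by (simp add: ideal_power_def ideals_set_def)
qed

text \<open>
  The lowest forms of two polynomials with respect to the degree in the variables of \<open>S\<close> multiply to
  the lowest form of the product, because the polynomial ring is a domain.
\<close>

lemma lowest_form_split:
  fixes p :: "'k::field mpoly"
  assumes "p \<noteq> 0"
  obtains d q r where "p = q + r" "q \<noteq> 0" "\<And>m. m \<in> Poly_Mapping.keys q \<Longrightarrow> var_order S m = d"
    "\<And>m. m \<in> Poly_Mapping.keys r \<Longrightarrow> d < var_order S m"
    "\<And>m. m \<in> Poly_Mapping.keys p \<Longrightarrow> d \<le> var_order S m"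
proof -
  have "\<exists>m. m \<in> Poly_Mapping.keys p" using assms by (metis all_not_in_conv keys_eq_empty)
  then obtain m0 where m0: "m0 \<in> Poly_Mapping.keys p"
    "\<And>m. m \<in> Poly_Mapping.keys p \<Longrightarrow> var_order S m0 \<le> var_order S m"
    using ex_has_least_nat[of "\<lambda>m. m \<in> Poly_Mapping.keys p" _ "var_order S"] by metis
  define d where "d = var_order S m0"
  define K where "K = {m \<in> Poly_Mapping.keys p. var_order S m = d}"
  define q where "q = (\<Sum>m\<in>K. Poly_Mapping.single m (Poly_Mapping.lookup p m))"
  have fin: "finite K" by (simp add: K_def)
  have lq: "Poly_Mapping.lookup q m = (if m \<in> K then Poly_Mapping.lookup p m else 0)" for m
    using fin by (auto simp: q_def lookup_sum lookup_single when_def)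
  have "Poly_Mapping.lookup q m0 \<noteq> 0" using m0 by (simp add: lq K_def d_def in_keys_iff)
  then have "q \<noteq> 0" by auto
  moreover have "var_order S m = d" if "m \<in> Poly_Mapping.keys q" for m
    using that by (auto simp: in_keys_iff lq K_def split: if_splits)
  moreover have "d < var_order S m" if "m \<in> Poly_Mapping.keys (p - q)" for m
  proof -
    have "m \<in> Poly_Mapping.keys p" "m \<notin> K"
      using that by (auto simp: in_keys_iff lookup_minus lq split: if_splits)
    then show ?thesis using m0(2)[of m] by (auto simp: K_def d_def)
  qed
  ultimately show ?thesis using that[of q "p - q" d] m0 by (auto simp: d_def)
qed

text \<open>The least degrees \<open>d\<close> of \<open>a\<close> and \<open>e\<close> of
  \<open>b\<close> are at most those of \<open>u\<close> and \<open>v\<close>, and the degree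
  \<open>d + e\<close> survives in the product.\<close>

lemma var_order_mult_attained:
  fixes a b :: "'k::field mpoly"
  assumes u: "u \<in> Poly_Mapping.keys a" and v: "v \<in> Poly_Mapping.keys b"
  obtains m where "m \<in> Poly_Mapping.keys (a * b)" "var_order S m \<le> var_order S u + var_order S v"
proof -
  have "a \<noteq> 0" "b \<noteq> 0" using u v by auto
  obtain d a0 a1 where a: "a = a0 + a1" "a0 \<noteq> 0"
    "\<And>m. m \<in> Poly_Mapping.keys a0 \<Longrightarrow> var_order S m = d"
    "\<And>m. m \<in> Poly_Mapping.keys a1 \<Longrightarrow> d < var_order S m"
    "\<And>m. m \<in> Poly_Mapping.keys a \<Longrightarrow> d \<le> var_order S m"
    using lowest_form_split[OF \<open>a \<noteq> 0\<close>, of S] by metis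
  obtain e b0 b1 where b: "b = b0 + b1" "b0 \<noteq> 0"
    "\<And>m. m \<in> Poly_Mapping.keys b0 \<Longrightarrow> var_order S m = e"
    "\<And>m. m \<in> Poly_Mapping.keys b1 \<Longrightarrow> e < var_order S m"
    "\<And>m. m \<in> Poly_Mapping.keys b \<Longrightarrow> e \<le> var_order S m"
    using lowest_form_split[OF \<open>b \<noteq> 0\<close>, of S] by metis
  have "a0 * b0 \<noteq> 0" using a(2) b(2) by simp
  then obtain m where m: "m \<in> Poly_Mapping.keys (a0 * b0)"
    by (metis all_not_in_conv keys_eq_empty)
  have m_order: "var_order S m = d + e"
    using m keys_mult[of a0 b0] a(3) b(3) by (force simp: var_order_add)
  \<comment> \<open>The other two parts of the product live strictly above degree
    \<open>d + e\<close>, so they cannot cancel the monomial \<open>m\<close> of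
    \<open>a0 * b0\<close>.\<close>
  have gt: "d + e < var_order S m'"
    if "m' \<in> Poly_Mapping.keys (a0 * b1) \<union> Poly_Mapping.keys (a1 * b)" for m'
    using that
  proof
    assume "m' \<in> Poly_Mapping.keys (a0 * b1)"
    then obtain x y where "m' = x + y" "x \<in> Poly_Mapping.keys a0" "y \<in> Poly_Mapping.keys b1"
      using keys_mult[of a0 b1] by blast
    then show ?thesis using a(3)[of x] b(4)[of y] by (simp add: var_order_add)
  next
    assume "m' \<in> Poly_Mapping.keys (a1 * b)"
    then obtain x y where "m' = x + y" "x \<in> Poly_Mapping.keys a1" "y \<in> Poly_Mapping.keys b"
      using keys_mult[of a1 b] by blast
    then show ?thesis using a(4)[of x] b(5)[of y] by (simp add: var_order_add)
  qed
  from gt[of m] m_order have "Poly_Mapping.lookup (a0 * b1) m = 0" "Poly_Mapping.lookup (a1 * b) m = 0"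
    by (auto simp: in_keys_iff)
  moreover have "a * b = a0 * b0 + a0 * b1 + a1 * b" by (simp add: a(1) b(1) algebra_simps)
  ultimately have "m \<in> Poly_Mapping.keys (a * b)" using m by (simp add: in_keys_iff lookup_add)
  with m_order a(5)[OF u] b(5)[OF v] show ?thesis by (intro that[of m]) auto
qed

text \<open>If \<open>b\<close> lies in the prime, its \<open>k\<close>-th power lies in the ideal.
  Otherwise \<open>b\<close> has a monomial free of the variables in \<open>S\<close>, and a
  monomial of \<open>a\<close> of degree below \<open>k\<close> would force one in
  \<open>a * b\<close>. Positivity of \<open>k\<close> keeps \<open>1\<close> out of the
  ideal.\<close>

lemma primary_order_ge:
  assumes "0 < k"
  shows "primary_ideal (mpoly_ring n) (order_ge n S k :: 'k::field mpoly set)"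
  unfolding primary_ideal_def
proof (intro conjI ballI impI)
  let ?R = "mpoly_ring n :: 'k mpoly ring"
  show "ideal (order_ge n S k) ?R" by (rule ideal_order_ge)
  have "(1 :: 'k mpoly) \<notin> order_ge n S k"
    using assms by (simp add: order_ge_def supported_in_def var_order_def)
  moreover have "(1 :: 'k mpoly) \<in> carrier ?R" by (simp add: mpoly_ring_def exponents_def)
  ultimately show "order_ge n S k \<noteq> carrier ?R" by blast
  fix a b assume a: "a \<in> carrier ?R" and b: "b \<in> carrier ?R" and ab: "a \<otimes>\<^bsub>?R\<^esub> b \<in> order_ge n S k"
  show "a \<in> order_ge n S k \<or> (\<exists>t::nat. 0 < t \<and> b [^]\<^bsub>?R\<^esub> t \<in> order_ge n S k)"
  proof (cases "b \<in> order_ge n S 1")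
    case True
    have "b [^]\<^bsub>?R\<^esub> t \<in> order_ge n S t" for t :: nat
    proof (induction t)
      case 0
      then show ?case by (simp add: order_ge_0 mpoly_ring_def exponents_def)
    next
      case (Suc t)
      then show ?case using order_ge_mult[OF _ True, of _ t] by (simp add: mpoly_ring_def)
    qed
    with assms show ?thesis by blast
  next
    case False
    then obtain v where v: "v \<in> Poly_Mapping.keys b" "var_order S v = 0"
      using b by (force simp: order_ge_def supported_in_def mpoly_ring_def)
    have "a \<in> order_ge n S k"
    proof (rule ccontr)
      assume "a \<notin> order_ge n S k"
      then obtain u where u: "u \<in> Poly_Mapping.keys a" "var_order S u < k"
        using a by (force simp: order_ge_def supported_in_def mpoly_ring_def)
      from var_order_mult_attained[OF u(1) v(1)]
      obtain m where "m \<in> Poly_Mapping.keys (a * b)" "var_order S m \<le> var_order S u + var_order S v"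
        by blast
      then show False using ab u v by (auto simp: order_ge_def supported_in_def mpoly_ring_def)
    qed
    then show ?thesis ..
  qed
qed


section \<open>Permutations of exponents\<close>

lemma lookup_perm_exp:
  "bij \<sigma> \<Longrightarrow> Poly_Mapping.lookup (perm_exp \<sigma> m) i = Poly_Mapping.lookup m (inv_into UNIV \<sigma> i)"
  by (simp add: perm_exp_def Poly_Mapping.map_key.rep_eq bij_imp_bij_inv bij_is_inj)

lemma lookup_perm_exp_apply:
  "bij \<sigma> \<Longrightarrow> Poly_Mapping.lookup (perm_exp \<sigma> m) (\<sigma> i) = Poly_Mapping.lookup m i"
  by (simp add: lookup_perm_exp bij_is_inj)

lemma perm_exp_exponents:
  assumes "\<sigma> permutes {1..n}" "m \<in> exponents n"
  shows "perm_exp \<sigma> m \<in> exponents n"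
proof -
  have "inj (inv_into UNIV \<sigma>)" by (rule permutes_inj[OF permutes_inv[OF assms(1)]])
  then show ?thesis
    using assms permutes_in_image[OF permutes_inv[OF assms(1)]]
    by (auto simp: perm_exp_def exponents_def Poly_Mapping.keys_map_key)
qed

lemma perm_poly_xmon:
  "perm_poly \<sigma> (xmon m :: 'k::field mpoly) = xmon (perm_exp \<sigma> m)"
  by (simp add: perm_poly_def xmon_def)

text \<open>One inclusion for all bijections suffices; the reverse one is its instance for the
  inverse.\<close>

lemma perm_poly_supported_in:
  assumes "bij \<sigma>"
  shows "perm_poly \<sigma> ` (supported_in U :: 'k::field mpoly set) = supported_in (perm_exp \<sigma> ` U)"
proof -
  have img: "perm_poly \<tau> p \<in> supported_in (perm_exp \<tau> ` V)"
    if "bij \<tau>" "p \<in> supported_in V" for \<tau> V and p :: "'k mpoly"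
  proof -
    have "m \<in> perm_exp \<tau> ` V" if "m \<in> Poly_Mapping.keys (perm_poly \<tau> p)" for m
    proof -
      have "perm_exp (inv_into UNIV \<tau>) m \<in> V"
        using that \<open>p \<in> supported_in V\<close> \<open>bij \<tau>\<close>
        by (auto simp: in_keys_iff lookup_perm_poly supported_in_def)
      then show ?thesis using perm_exp_inv[OF \<open>bij \<tau>\<close>, of m] by force
    qed
    then show ?thesis by (auto simp: supported_in_def)
  qed
  show ?thesis
  proof (intro equalityI subsetI)
    fix p :: "'k mpoly" assume "p \<in> supported_in (perm_exp \<sigma> ` U)"
    then have "perm_poly (inv_into UNIV \<sigma>) p
        \<in> supported_in (perm_exp (inv_into UNIV \<sigma>) ` perm_exp \<sigma> ` U)"
      by (rule img[OF bij_imp_bij_inv[OF assms]])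
    then have "perm_poly (inv_into UNIV \<sigma>) p \<in> supported_in U"
      by (simp add: image_image perm_exp_inv'[OF assms])
    then show "p \<in> perm_poly \<sigma> ` supported_in U"
      by (metis perm_poly_inv[OF assms] imageI)
  qed (use img[OF assms] in blast)
qed

text \<open>Permuting the variables carries the degree in \<open>S\<close> to the degree in the
  image of \<open>S\<close>.\<close>

lemma perm_poly_order_ge:
  assumes s: "\<sigma> permutes {1..n}"
  shows "perm_poly \<sigma> ` (order_ge n S k :: 'k::field mpoly set) = order_ge n (\<sigma> ` S) k"
proof -
  note bij = permutes_bij[OF s]
  have ord: "var_order (\<sigma> ` S) (perm_exp \<sigma> m) = var_order S m" for m
    using bij_is_inj[OF bij] unfolding var_order_def
    by (subst sum.reindex) (auto simp: inj_on_def lookup_perm_exp_apply[OF bij] dest: injD)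
  have "perm_exp \<sigma> ` {m \<in> exponents n. k \<le> var_order S m}
      = {m \<in> exponents n. k \<le> var_order (\<sigma> ` S) m}" (is "_ ` ?A = ?B")
  proof (intro equalityI subsetI)
    fix m assume "m \<in> ?B"
    then have "perm_exp (inv_into UNIV \<sigma>) m \<in> ?A"
      using perm_exp_exponents[OF permutes_inv[OF s]] ord[of "perm_exp (inv_into UNIV \<sigma>) m"]
      by (simp add: perm_exp_inv[OF bij])
    then show "m \<in> perm_exp \<sigma> ` ?A" using perm_exp_inv[OF bij, of m] by (metis imageI)
  qed (auto simp: ord perm_exp_exponents[OF s])
  then show ?thesis by (simp add: order_ge_def perm_poly_supported_in[OF bij])
qed

section \<open>Sorting exponent vectors\<close>

lemma ex_sorting_permutation:
  fixes f :: "nat \<Rightarrow> nat"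
  obtains \<sigma> where "\<sigma> permutes {1..n}"
    "\<And>i j. 1 \<le> i \<Longrightarrow> i \<le> j \<Longrightarrow> j \<le> n \<Longrightarrow> f (\<sigma> i) \<le> f (\<sigma> j)"
proof -
  define xs where "xs = sort_key f [1..<Suc n]"
  \<comment> \<open>The sorted list of indices is read as a permutation; the offset reconciles list
    positions from 0 with variables from 1.\<close>
  define \<sigma> where "\<sigma> = (\<lambda>i. if i \<in> {1..n} then xs ! (i - 1) else i)"
  have xs: "length xs = n" "distinct xs" "set xs = {1..n}" "sorted (map f xs)"
    by (auto simp: xs_def)
  have "bij_betw (\<lambda>i. i - 1) {1..n} {..<n}"
    by (rule bij_betwI[where g = Suc]) auto
  from bij_betw_trans[OF this bij_betw_nth[OF xs(2)]]
  have "bij_betw ((!) xs \<circ> (\<lambda>i. i - 1)) {1..n} {1..n}"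
    using xs by auto
  then have "bij_betw \<sigma> {1..n} {1..n}"
    by (rule bij_betw_cong[THEN iffD1, rotated]) (auto simp: \<sigma>_def)
  then have "\<sigma> permutes {1..n}"
    by (rule bij_imp_permutes) (auto simp: \<sigma>_def)
  moreover have "f (\<sigma> i) \<le> f (\<sigma> j)" if "1 \<le> i" "i \<le> j" "j \<le> n" for i j
    using sorted_nth_mono[OF xs(4), of "i - 1" "j - 1"] that xs(1) by (auto simp: \<sigma>_def)
  ultimately show ?thesis by (rule that)
qed

lemma ex_perm_exp_partition:
  assumes "m \<in> exponents n"
  obtains \<sigma> where "\<sigma> permutes {1..n}" "perm_exp \<sigma> m \<in> partitions n"
proof -
  obtain \<tau> where t: "\<tau> permutes {1..n}" "\<And>i j. 1 \<le> i \<Longrightarrow> i \<le> j \<Longrightarrow> j \<le> n \<Longrightarrow>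
      Poly_Mapping.lookup m (\<tau> i) \<le> Poly_Mapping.lookup m (\<tau> j)"
    using ex_sorting_permutation[of n "Poly_Mapping.lookup m"] by blast
  \<comment> \<open>The inverse is taken because \<open>perm_exp\<close> itself evaluates at the
    inverse permutation.\<close>
  have s: "inv_into UNIV \<tau> permutes {1..n}" by (rule permutes_inv[OF t(1)])
  have "perm_exp (inv_into UNIV \<tau>) m \<in> partitions n"
    using perm_exp_exponents[OF s assms] t(2)
    by (simp add: partitions_def lookup_perm_exp permutes_bij[OF s] inv_inv_eq permutes_bij[OF t(1)])
  with s show ?thesis by (rule that)
qed


section \<open>Dominance\<close>

text \<open>The exponents of the monomials in the claimed intersection. The subsets of size
  \<open>j\<close> are presented as images of \<open>{1..j}\<close> to match the indexing of the
  components.\<close>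

definition dominating :: "nat \<Rightarrow> (nat \<Rightarrow>\<^sub>0 nat) \<Rightarrow> (nat \<Rightarrow>\<^sub>0 nat) set" where
  "dominating n l = {m \<in> exponents n. \<forall>\<sigma>. \<sigma> permutes {1..n} \<longrightarrow>
     (\<forall>j\<in>{1..n}. (\<Sum>i=1..j. Poly_Mapping.lookup l i) \<le> var_order (\<sigma> ` {1..j}) m)}"

text \<open>Building \<open>S\<close> up in increasing order, a new maximum \<open>b\<close> exceeds
  the number of elements already present, so monotonicity bounds the next initial term by
  \<open>f b\<close>.\<close>

lemma sum_initial_le:
  fixes f :: "nat \<Rightarrow> nat"
  assumes mono: "\<And>i j. 1 \<le> i \<Longrightarrow> i \<le> j \<Longrightarrow> j \<le> n \<Longrightarrow> f i \<le> f j"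
    and "finite S" "S \<subseteq> {1..n}"
  shows "(\<Sum>i=1..card S. f i) \<le> (\<Sum>i\<in>S. f i)"
  using assms(2,3)
proof (induction S rule: finite_linorder_max_induct)
  case (insert b A)
  then have "b \<notin> A" by blast
  have "A \<subseteq> {1..<b}" using insert by auto
  then have "card A \<le> b - 1" using card_mono[of "{1..<b}" A] by simp
  then have "f (Suc (card A)) \<le> f b" using insert.prems by (intro mono) auto
  then show ?case using insert \<open>b \<notin> A\<close> by simp
qed simp

lemma partition_in_dominating:
  assumes "l \<in> partitions n"
  shows "l \<in> dominating n l"
proof -
  have "(\<Sum>i=1..j. Poly_Mapping.lookup l i) \<le> var_order (\<sigma> ` {1..j}) l"
    if s: "\<sigma> permutes {1..n}" and j: "j \<in> {1..n}" for \<sigma> j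
  proof -
    have "\<sigma> ` {1..j} \<subseteq> \<sigma> ` {1..n}" using j by (intro image_mono) auto
    then have sub: "\<sigma> ` {1..j} \<subseteq> {1..n}" unfolding permutes_image[OF s] .
    have "card (\<sigma> ` {1..j}) = j"
      by (subst card_image) (auto intro: inj_on_subset[OF permutes_inj[OF s]])
    with sum_initial_le[OF _ _ sub, of "Poly_Mapping.lookup l"] assms show ?thesis
      by (simp add: var_order_def partitions_def)
  qed
  with assms show ?thesis by (simp add: dominating_def partitions_def)
qed

lemma dominating_add:
  "m \<in> dominating n l \<Longrightarrow> c \<in> exponents n \<Longrightarrow> m + c \<in> dominating n l"
  by (auto simp: dominating_def exponents_add var_order_add trans_le_add1)

text \<open>Permuting \<open>m\<close> only reindexes the permutations over which the bounds
  range.\<close>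

lemma perm_exp_dominating:
  assumes t: "\<tau> permutes {1..n}" and m: "m \<in> dominating n l"
  shows "perm_exp \<tau> m \<in> dominating n l"
proof -
  note bij = permutes_bij[OF t]
  let ?i = "inv_into UNIV \<tau>"
  have ord: "var_order A (perm_exp \<tau> m) = var_order (?i ` A) m" for A
    unfolding var_order_def using bij_is_inj[OF bij_imp_bij_inv[OF bij]]
    by (subst sum.reindex) (auto simp: lookup_perm_exp[OF bij] inj_on_def dest: injD)
  have "(\<Sum>i=1..j. Poly_Mapping.lookup l i) \<le> var_order (\<sigma> ` {1..j}) (perm_exp \<tau> m)"
    if "\<sigma> permutes {1..n}" "j \<in> {1..n}" for \<sigma> j
  proof -
    have "(?i \<circ> \<sigma>) permutes {1..n}" by (rule permutes_compose[OF that(1) permutes_inv[OF t]])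
    then have "(\<Sum>i=1..j. Poly_Mapping.lookup l i) \<le> var_order ((?i \<circ> \<sigma>) ` {1..j}) m"
      using m that(2) unfolding dominating_def by blast
    then show ?thesis by (simp only: ord image_comp)
  qed
  then show ?thesis
    using m perm_exp_exponents[OF t] by (simp add: dominating_def)
qed

section \<open>Shifts of exponents\<close>

lemma exponents_shift:
  assumes "m \<in> exponents n" "i \<in> {1..n}"
  shows "m + Poly_Mapping.single i 1 - Poly_Mapping.single j 1 \<in> exponents n"
proof -
  have "m + Poly_Mapping.single i 1 \<in> exponents n"
    using assms by (intro exponents_add) (auto simp: exponents_def)
  then show ?thesis
    by (auto simp: exponents_def subset_iff in_keys_iff lookup_minus simp del: atLeastAtMost_iff)
qed

text \<open>Undoing the truncated subtraction lets the effect of a shift be computed by addition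
  alone.\<close>

lemma shift_add_single:
  fixes m :: "nat \<Rightarrow>\<^sub>0 nat"
  assumes "Poly_Mapping.lookup m j \<noteq> 0"
  shows "m + Poly_Mapping.single i 1 - Poly_Mapping.single j 1 + Poly_Mapping.single j 1
    = m + Poly_Mapping.single i 1"
  using assms
  by (intro poly_mapping_eqI) (auto simp: lookup_add lookup_minus lookup_single when_def)

lemma var_order_shift:
  assumes "finite A" "Poly_Mapping.lookup m j \<noteq> 0"
  shows "var_order A (m + Poly_Mapping.single i 1 - Poly_Mapping.single j 1) + (if j \<in> A then 1 else 0)
    = var_order A m + (if i \<in> A then 1 else 0)"
proof -
  have "var_order A (Poly_Mapping.single k 1) = (if k \<in> A then 1 else 0)" for k
    using assms(1) by (simp add: var_order_def lookup_single when_def)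
  then show ?thesis using arg_cong[OF shift_add_single[OF assms(2), of i], of "var_order A"]
    unfolding var_order_add by simp
qed

text \<open>
  Only a set \<open>A\<close> with \<open>j \<in> A\<close> and \<open>i \<notin> A\<close> loses weight under the shift, and there the bound for \<open>A\<close>
  with \<open>j\<close> exchanged for \<open>i\<close> has room to spare.
\<close>

lemma dominating_shift:
  assumes m: "m \<in> dominating n l" and ij: "i \<in> {1..n}" "j \<in> {1..n}"
    and less: "Poly_Mapping.lookup m i < Poly_Mapping.lookup m j"
  shows "m + Poly_Mapping.single i 1 - Poly_Mapping.single j 1 \<in> dominating n l" (is "?m \<in> _")
proof -
  have "(\<Sum>i=1..k. Poly_Mapping.lookup l i) \<le> var_order (\<sigma> ` {1..k}) ?m"
    if s: "\<sigma> permutes {1..n}" and k: "k \<in> {1..n}" for \<sigma> k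
  proof -
    let ?A = "\<sigma> ` {1..k}"
    have bound: "(\<Sum>i=1..k. Poly_Mapping.lookup l i) \<le> var_order (\<tau> ` {1..k}) m"
      if "\<tau> permutes {1..n}" for \<tau> using m that k by (simp add: dominating_def)
    show ?thesis
    proof (cases "j \<in> ?A \<and> i \<notin> ?A")
      case False
      then have "var_order ?A m \<le> var_order ?A ?m"
        using var_order_shift[of ?A m j i] less by (auto split: if_splits)
      with bound[OF s] show ?thesis by simp
    next
      case True
      let ?t = "transpose i j"
      have "(?t \<circ> \<sigma>) permutes {1..n}"
        by (rule permutes_compose[OF s permutes_swap_id[OF ij]])
      from bound[OF this] have "(\<Sum>i=1..k. Poly_Mapping.lookup l i) \<le> var_order (?t ` ?A) m"
        by (simp add: image_comp)
      also have "\<dots> = (\<Sum>b\<in>?A. Poly_Mapping.lookup m (?t b))"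
        unfolding var_order_def by (subst sum.reindex) auto
      also have "\<dots> \<le> var_order ?A ?m"
        unfolding var_order_def
      proof (rule sum_mono)
        \<comment> \<open>At \<open>b = j\<close> the strict inequality between the entries pays for
          the lost unit; at every other \<open>b\<close> in the set the entry is unchanged.\<close>
        fix b assume "b \<in> ?A"
        with True have "b \<noteq> i" by blast
        then show "Poly_Mapping.lookup m (?t b) \<le> Poly_Mapping.lookup ?m b"
          using less
          by (cases "b = j") (auto simp: lookup_add lookup_minus lookup_single when_def transpose_def)
      qed
      finally show ?thesis .
    qed
  qed
  then show ?thesis using m exponents_shift[OF _ ij(1)] by (simp add: dominating_def)
qed

text \<open>With \<open>partition_in_dominating\<close> this bounds \<open>Sss n {l}\<close> from
  above by minimality.\<close>

lemma sym_strongly_shifted_dominating: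
  "sym_strongly_shifted n (supported_in (dominating n l) :: 'k::field mpoly set)"
proof -
  have sub: "dominating n l \<subseteq> exponents n" by (auto simp: dominating_def)
  have "perm_exp \<sigma> ` dominating n l = dominating n l" if s: "\<sigma> permutes {1..n}" for \<sigma>
    using perm_exp_dominating[OF s] perm_exp_dominating[OF permutes_inv[OF s]]
      perm_exp_inv[OF permutes_bij[OF s]] by (metis image_eqI image_subsetI subsetI subset_antisym)
  then have "sym_fixed n (supported_in (dominating n l) :: 'k mpoly set)"
    by (simp add: sym_fixed_def perm_poly_supported_in permutes_bij)
  moreover have "monomial_ideal n (supported_in (dominating n l) :: 'k mpoly set)"
    by (rule monomial_ideal_supported_in[OF sub dominating_add])
  moreover have "m + Poly_Mapping.single i 1 - Poly_Mapping.single j 1 \<in> dominating n l"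
    if "m \<in> dominating n l" "1 \<le> i" "i < j" "j \<le> n"
      "Poly_Mapping.lookup m i < Poly_Mapping.lookup m j" for m i j
    using that(2-4) by (intro dominating_shift[OF that(1) _ _ that(5)]) auto
  ultimately show ?thesis
    by (simp add: sym_strongly_shifted_def partitions_of_def)
qed

text \<open>Extends the shift axiom, which covers sorted exponents and \<open>i < j\<close> only.
  After sorting by \<open>\<sigma>\<close>, the strict inequality of the entries forces
  \<open>\<sigma> i < \<sigma> j\<close>; the shift commutes with \<open>\<sigma>\<close>, and
  symmetry of \<open>I\<close> transports the result back.\<close>

lemma shift_mem:
  fixes I :: "'k::field mpoly set"
  assumes I: "sym_strongly_shifted n I" and m: "xmon m \<in> I" "m \<in> exponents n"
    and ij: "i \<in> {1..n}" "j \<in> {1..n}" and less: "Poly_Mapping.lookup m i < Poly_Mapping.lookup m j"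
  shows "xmon (m + Poly_Mapping.single i 1 - Poly_Mapping.single j 1) \<in> I"
proof -
  obtain \<sigma> where s: "\<sigma> permutes {1..n}" "perm_exp \<sigma> m \<in> partitions n"
    using ex_perm_exp_partition[OF m(2)] by blast
  note bij = permutes_bij[OF s(1)]
  let ?p = "perm_exp \<sigma> m"
  have sI: "perm_poly \<sigma> ` I = I"
    using I s(1) unfolding sym_strongly_shifted_def sym_fixed_def by blast
  have p: "?p \<in> partitions_of n I"
    using s(2) m(1) sI unfolding partitions_of_def by (auto simp flip: perm_poly_xmon)
  have img: "\<sigma> i \<in> {1..n}" "\<sigma> j \<in> {1..n}"
    using ij permutes_in_image[OF s(1)] by blast+
  have less': "Poly_Mapping.lookup ?p (\<sigma> i) < Poly_Mapping.lookup ?p (\<sigma> j)"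
    using less by (simp add: lookup_perm_exp_apply[OF bij])
  have "\<sigma> i < \<sigma> j"
  proof (rule ccontr)
    assume "\<not> \<sigma> i < \<sigma> j"
    then have "Poly_Mapping.lookup ?p (\<sigma> j) \<le> Poly_Mapping.lookup ?p (\<sigma> i)"
      using s(2) img by (simp add: partitions_def)
    with less' show False by simp
  qed
  then have "xmon (?p + Poly_Mapping.single (\<sigma> i) 1 - Poly_Mapping.single (\<sigma> j) 1) \<in> I"
    using I p img less' unfolding sym_strongly_shifted_def by auto
  moreover have "?p + Poly_Mapping.single (\<sigma> i) 1 - Poly_Mapping.single (\<sigma> j) 1
      = perm_exp \<sigma> (m + Poly_Mapping.single i 1 - Poly_Mapping.single j 1)"
  proof (rule poly_mapping_eqI)
    fix k
    obtain k' where "k = \<sigma> k'" using bij by (metis bij_pointE)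
    moreover have "\<sigma> a = \<sigma> b \<longleftrightarrow> a = b" for a b using bij_is_inj[OF bij] by (auto dest: injD)
    ultimately show "Poly_Mapping.lookup (?p + Poly_Mapping.single (\<sigma> i) 1 - Poly_Mapping.single (\<sigma> j) 1) k
      = Poly_Mapping.lookup (perm_exp \<sigma> (m + Poly_Mapping.single i 1 - Poly_Mapping.single j 1)) k"
      by (simp add: lookup_add lookup_minus lookup_single when_def lookup_perm_exp_apply[OF bij])
  qed
  ultimately have "perm_poly \<sigma> (xmon (m + Poly_Mapping.single i 1 - Poly_Mapping.single j 1)) \<in> I"
    by (simp add: perm_poly_xmon)
  \<comment> \<open>As \<open>I\<close> equals its own image, the permuted monomial has a preimage
    in \<open>I\<close>; injectivity identifies it with the unpermuted monomial.\<close>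
  then obtain q where q: "q \<in> I"
    "perm_poly \<sigma> (xmon (m + Poly_Mapping.single i 1 - Poly_Mapping.single j 1)) = perm_poly \<sigma> q"
    using sI by blast
  have "inj (perm_poly \<sigma> :: 'k mpoly \<Rightarrow> _)"
    using perm_poly_inv[OF bij_imp_bij_inv[OF bij]] by (metis inv_inv_eq[OF bij] injI)
  with q show ?thesis by (auto dest: injD)
qed

text \<open>
  The partition \<open>m\<close> is reached from \<open>a\<close> by unit moves, each of which raises some initial sums of \<open>a\<close>
  and keeps all of them below those of \<open>m\<close>: increase the last entry if the totals differ; otherwise
  move a unit from \<open>j\<close> to the first position \<open>i\<close> where \<open>a\<close> and \<open>m\<close> differ, with \<open>j\<close> the next index at
  which the initial sums agree again. Then \<open>a i < m i \<le> m j < a j\<close>, so \<open>a\<close> itself need not be sorted.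
\<close>

lemma dominance_closure:
  fixes M :: "(nat \<Rightarrow>\<^sub>0 nat) set"
  assumes M: "M \<subseteq> exponents n"
    and add: "\<And>a. a \<in> M \<Longrightarrow> 0 < n \<Longrightarrow> a + Poly_Mapping.single n 1 \<in> M"
    and shift: "\<And>a i j. a \<in> M \<Longrightarrow> i \<in> {1..n} \<Longrightarrow> j \<in> {1..n} \<Longrightarrow>
      Poly_Mapping.lookup a i < Poly_Mapping.lookup a j \<Longrightarrow>
      a + Poly_Mapping.single i 1 - Poly_Mapping.single j 1 \<in> M"
    and m: "m \<in> partitions n"
    and "a \<in> M" "\<And>k. k \<le> n \<Longrightarrow> var_order {1..k} a \<le> var_order {1..k} m"
  shows "m \<in> M"
  using assms(5,6)
\<comment> \<open>The measure is the total gap between the initial sums; its differences are never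
  truncated, as the sums of \<open>a\<close> stay below those of \<open>m\<close>.\<close>
proof (induction "\<Sum>k\<le>n. var_order {1..k} m - var_order {1..k} a" arbitrary: a rule: less_induct)
  case less
  let ?o = "\<lambda>k. var_order {1..k}"
  have o_Suc: "?o (Suc k) b = ?o k b + Poly_Mapping.lookup b (Suc k)" for k b
    by (simp add: var_order_def)
  have step: "m \<in> M" if b: "b \<in> M" "\<And>k. k \<le> n \<Longrightarrow> ?o k a \<le> ?o k b"
    "\<And>k. k \<le> n \<Longrightarrow> ?o k b \<le> ?o k m" "k0 \<le> n" "?o k0 a < ?o k0 b" for b k0
  proof (rule less.hyps[OF _ b(1) b(3)])
    show "(\<Sum>k\<le>n. ?o k m - ?o k b) < (\<Sum>k\<le>n. ?o k m - ?o k a)"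
    proof (rule sum_strict_mono_ex1)
      show "\<exists>k\<in>{..n}. ?o k m - ?o k b < ?o k m - ?o k a"
        using b(3)[of k0] b(4,5) by (intro bexI[of _ k0]) auto
    qed (use b(2) in \<open>auto intro: diff_le_mono2\<close>)
  qed
  consider (total) "?o n a < ?o n m" | (eq) "\<And>k. k \<le> n \<Longrightarrow> ?o k a = ?o k m"
    | (move) "?o n a = ?o n m" "\<exists>k\<le>n. ?o k a \<noteq> ?o k m"
    using less.prems(2)[of n] by fastforce
  then show ?case
  proof cases
    case total
    then have n: "0 < n" by (cases n) (auto simp: var_order_def)
    let ?b = "a + Poly_Mapping.single n 1"
    \<comment> \<open>The last entry enters only the full sum, which has room in this case.\<close>
    have o: "?o k ?b = ?o k a + (if k = n then 1 else 0)" if "k \<le> n" for k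
    proof -
      have "var_order {1..k} (Poly_Mapping.single n 1) = (if k = n then 1 else 0)"
        using that n by (auto simp: var_order_def lookup_single when_def)
      then show ?thesis by (simp add: var_order_add)
    qed
    show ?thesis
      by (rule step[of ?b n]) (use o total less.prems(2) add[OF less.prems(1) n] in auto)
  next
    case eq
    have "Poly_Mapping.lookup a k = Poly_Mapping.lookup m k" for k
    proof (cases "k \<in> {1..n}")
      case True
      then obtain k' where "k = Suc k'" by (cases k) auto
      with True eq[of k] eq[of k'] o_Suc[of k' a] o_Suc[of k' m] show ?thesis by simp
    next
      case False
      have "Poly_Mapping.keys a \<subseteq> {1..n}" "Poly_Mapping.keys m \<subseteq> {1..n}"
        using less.prems(1) M m by (auto simp: exponents_def partitions_def)
      with False have "k \<notin> Poly_Mapping.keys a" "k \<notin> Poly_Mapping.keys m" by blast+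
      then show ?thesis by (simp add: in_keys_iff)
    qed
    then have "a = m" by (rule poly_mapping_eqI)
    with less.prems(1) show ?thesis by simp
  next
    case move
    define i where "i = (LEAST k. k \<le> n \<and> ?o k a \<noteq> ?o k m)"
    have i: "i \<le> n" "?o i a \<noteq> ?o i m"
      using LeastI_ex[OF move(2)] by (simp_all add: i_def)
    have below: "?o k a = ?o k m" if "k < i" for k
      using not_less_Least[OF that[unfolded i_def]] that i(1) by simp
    obtain i' where i': "i = Suc i'" using i(2) by (cases i) (auto simp: var_order_def)
    have i_less: "?o i a < ?o i m" using i less.prems(2)[of i] by simp
    then have ai: "Poly_Mapping.lookup a i < Poly_Mapping.lookup m i"
      using below[of i'] i' o_Suc[of i' a] o_Suc[of i' m] by simp
    have "i < n" using move(1) i by (cases "i = n") auto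
    define j where "j = (LEAST k. i < k \<and> k \<le> n \<and> ?o k a = ?o k m)"
    have j: "i < j" "j \<le> n" "?o j a = ?o j m"
      \<comment> \<open>The index \<open>n\<close> is a candidate: the totals agree and
        \<open>i < n\<close>.\<close>
      using LeastI[of "\<lambda>k. i < k \<and> k \<le> n \<and> ?o k a = ?o k m" n] \<open>i < n\<close> move(1)
      by (simp_all add: j_def)
    have between: "?o k a < ?o k m" if "i \<le> k" "k < j" for k
    proof (cases "k = i")
      case False
      then have "?o k a \<noteq> ?o k m" using not_less_Least[OF that(2)[unfolded j_def]] that j(2) by auto
      then show ?thesis using less.prems(2)[of k] that j(2) by simp
    qed (use i_less in simp)
    obtain j' where j': "j = Suc j'" using j(1) by (cases j) auto
    \<comment> \<open>The sums up to \<open>j - 1\<close> still differ while those up to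
      \<open>j\<close> agree, so \<open>a\<close> catches up exactly at \<open>j\<close>.\<close>
    have aj: "Poly_Mapping.lookup m j < Poly_Mapping.lookup a j"
      using between[of j'] j j' o_Suc[of j' a] o_Suc[of j' m] by simp
    have "Poly_Mapping.lookup m i \<le> Poly_Mapping.lookup m j"
      using m j i' by (simp add: partitions_def)
    with ai aj have lt: "Poly_Mapping.lookup a i < Poly_Mapping.lookup a j" by simp
    let ?b = "a + Poly_Mapping.single i 1 - Poly_Mapping.single j 1"
    \<comment> \<open>The moved unit counts in the sums from \<open>i\<close> on and is taken away
      again from \<open>j\<close> on. In between there is a strict gap.\<close>
    have o: "?o k ?b = ?o k a + (if i \<le> k \<and> k < j then 1 else 0)" for k
    proof -
      have "?o k ?b + (if j \<in> {1..k} then 1 else 0) = ?o k a + (if i \<in> {1..k} then 1 else 0)"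
        using lt by (intro var_order_shift) auto
      moreover have "i \<in> {1..k} \<longleftrightarrow> i \<le> k" "j \<in> {1..k} \<longleftrightarrow> j \<le> k" using i' j(1) by auto
      ultimately show ?thesis using j(1) by (cases "i \<le> k"; cases "j \<le> k") auto
    qed
    have "?b \<in> M" using shift[OF less.prems(1) _ _ lt] i i' j by auto
    then show ?thesis
      by (rule step[of _ i]) (use o between less.prems(2) i(1) j(1) in \<open>auto simp: Suc_leI\<close>)
  qed
qed

section \<open>The generated ideal and its decomposition\<close>

text \<open>For the lower bound, a dominating exponent is sorted, reached from \<open>l\<close> by
  \<open>dominance_closure\<close> inside the set of exponents of the ideal, and unsorted by
  symmetry.\<close>

lemma Sss_eq_supported_in_dominating:
  assumes l: "l \<in> partitions n"
  shows "Sss n {l} = (supported_in (dominating n l) :: 'k::field mpoly set)"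
proof
  let ?I = "Sss n {l} :: 'k mpoly set"
  have B: "{l} \<subseteq> partitions n" using l by simp
  note I = Sss_least(1)[OF B, where 'k = 'k] and lI = Sss_least(2)[OF B, where 'k = 'k]
  show "?I \<subseteq> supported_in (dominating n l)"
    by (rule Sss_least(3)[OF B sym_strongly_shifted_dominating])
      (simp add: partition_in_dominating[OF l])
  have idI: "ideal ?I (mpoly_ring n)"
    using I unfolding sym_strongly_shifted_def monomial_ideal_iff by blast
  show "supported_in (dominating n l) \<subseteq> ?I"
  proof (rule supported_in_subset_ideal[OF idI])
    fix m assume m: "m \<in> dominating n l"
    then obtain \<sigma> where s: "\<sigma> permutes {1..n}" "perm_exp \<sigma> m \<in> partitions n"
      using ex_perm_exp_partition[of m n] by (auto simp: dominating_def)
    let ?M = "{a \<in> exponents n. (xmon a :: 'k mpoly) \<in> ?I}"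
    have "perm_exp \<sigma> m \<in> ?M"
    proof (rule dominance_closure[OF _ _ _ s(2), of _ l])
      fix a assume a: "a \<in> ?M" and "0 < n"
      then have e: "Poly_Mapping.single n 1 \<in> exponents n" by (auto simp: exponents_def)
      then have "(xmon (Poly_Mapping.single n 1) :: 'k mpoly) \<in> carrier (mpoly_ring n)"
        by (simp add: mpoly_ring_def xmon_def)
      with a have "xmon a * xmon (Poly_Mapping.single n 1) \<in> ?I"
        using ideal_mpoly_closed(3)[OF idI] by blast
      with a e show "a + Poly_Mapping.single n 1 \<in> ?M"
        by (simp add: xmon_def mult_single exponents_add)
    next
      fix k assume "k \<le> n"
      show "var_order {1..k} l \<le> var_order {1..k} (perm_exp \<sigma> m)"
      proof (cases "k = 0")
        case False
        then have "k \<in> {1..n}" using \<open>k \<le> n\<close> by simp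
        moreover have "perm_exp \<sigma> m \<in> dominating n l" by (rule perm_exp_dominating[OF s(1) m])
        ultimately show ?thesis
          \<comment> \<open>The identity permutation yields the initial sums; \<open>k = 0\<close>
            is separate since the bounds start at 1.\<close>
          unfolding dominating_def using permutes_id[of "{1..n}"]
          by (auto simp: var_order_def dest!: spec[of _ id])
      qed (simp add: var_order_def)
    qed (use l lI exponents_shift shift_mem[OF I] in \<open>auto simp: partitions_def\<close>)
    then have "xmon (perm_exp \<sigma> m) \<in> ?I" by simp
    moreover have "perm_poly (inv_into UNIV \<sigma>) ` ?I = ?I"
      using I permutes_inv[OF s(1)] unfolding sym_strongly_shifted_def sym_fixed_def by blast
    ultimately have "perm_poly (inv_into UNIV \<sigma>) (xmon (perm_exp \<sigma> m)) \<in> ?I" by blast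
    then show "xmon m \<in> ?I"
      by (simp add: perm_poly_xmon perm_exp_inv' permutes_bij[OF s(1)])
  qed
qed

lemma ideal_power_perm_var_ideal:
  assumes "j \<in> {1..n}" "\<sigma> permutes {1..n}"
  shows "ideal_power (mpoly_ring n) (perm_var_ideal n j \<sigma> :: 'k::field mpoly set) k
    = order_ge n (\<sigma> ` {1..j}) k"
proof -
  have "(perm_var_ideal n j \<sigma> :: 'k mpoly set) = order_ge n (\<sigma> ` {1..j}) 1"
    using assms by (simp add: perm_var_ideal_def genideal_xvar perm_poly_order_ge)
  then show ?thesis by (simp only: ideal_power_order_ge finite_imageI finite_atLeastAtMost)
qed

theorem theorem2:
  fixes n :: nat and l :: "nat \<Rightarrow>\<^sub>0 nat" and I :: "'k::field mpoly set"
  assumes "l \<in> partitions n" and "l \<noteq> 0"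
    and "I = Sss n {l}"
  shows "I = (\<Inter>j\<in>{1..n}. \<Inter>\<sigma>\<in>{\<sigma>. \<sigma> permutes {1..n}}.
               ideal_power (mpoly_ring n) (perm_var_ideal n j \<sigma>) (\<Sum>i=1..j. Poly_Mapping.lookup l i))
       \<and> primary_decomposition (mpoly_ring n) I
           {(j, \<sigma>). j \<in> {1..n} \<and> \<sigma> permutes {1..n} \<and> (\<Sum>i=1..j. Poly_Mapping.lookup l i) \<noteq> 0}
           (\<lambda>(j, \<sigma>). ideal_power (mpoly_ring n) (perm_var_ideal n j \<sigma>) (\<Sum>i=1..j. Poly_Mapping.lookup l i))"
proof -
  define s where "s j = (\<Sum>i=1..j. Poly_Mapping.lookup l i)" for j
  define Q :: "nat \<Rightarrow> (nat \<Rightarrow> nat) \<Rightarrow> 'k mpoly set"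
    where "Q j \<sigma> = ideal_power (mpoly_ring n) (perm_var_ideal n j \<sigma>) (s j)" for j \<sigma>
  let ?A = "{(j, \<sigma>). j \<in> {1..n} \<and> \<sigma> permutes {1..n} \<and> s j \<noteq> 0}"
  have I: "I = supported_in (dominating n l)"
    using assms Sss_eq_supported_in_dominating by blast
  have Q: "Q j \<sigma> = order_ge n (\<sigma> ` {1..j}) (s j)" if "j \<in> {1..n}" "\<sigma> permutes {1..n}" for j \<sigma>
    unfolding Q_def by (rule ideal_power_perm_var_ideal[OF that])
  \<comment> \<open>Components with exponent zero are the whole ring, so leaving them out of the
    index set does not change the intersection within the ring.\<close>
  have zero: "Q j \<sigma> = carrier (mpoly_ring n)" if "s j = 0" for j \<sigma>
    unfolding Q_def that by (simp add: ideal_power_def ideals_set_def)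
  \<comment> \<open>A nonzero \<open>l\<close> forces a variable to exist; otherwise the
    intersection over \<open>j\<close> would be empty and equal to the whole type.\<close>
  have n: "1 \<in> {1..n}"
  proof -
    obtain i where "i \<in> Poly_Mapping.keys l"
      using assms(2) by (metis all_not_in_conv keys_eq_empty)
    then show ?thesis using assms(1) by (fastforce simp: partitions_def exponents_def)
  qed
  have "p \<in> I \<longleftrightarrow> p \<in> carrier (mpoly_ring n) \<and>
      (\<forall>j\<in>{1..n}. \<forall>\<sigma>. \<sigma> permutes {1..n} \<longrightarrow> p \<in> order_ge n (\<sigma> ` {1..j}) (s j))" for p
    unfolding I order_ge_def supported_in_def dominating_def mpoly_ring_def s_def by auto
  then have mem: "p \<in> I \<longleftrightarrow> p \<in> carrier (mpoly_ring n) \<and>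
      (\<forall>j\<in>{1..n}. \<forall>\<sigma>. \<sigma> permutes {1..n} \<longrightarrow> p \<in> Q j \<sigma>)" for p
    using Q by blast
  \<comment> \<open>A single component inside the ring makes the explicit carrier condition
    redundant in the plain intersection.\<close>
  have "p \<in> carrier (mpoly_ring n)" if "p \<in> Q 1 id" for p
    using that unfolding Q[OF n permutes_id] order_ge_def supported_in_def mpoly_ring_def by auto
  then have "I = (\<Inter>j\<in>{1..n}. \<Inter>\<sigma>\<in>{\<sigma>. \<sigma> permutes {1..n}}. Q j \<sigma>)"
    using mem n permutes_id[of "{1..n}"] by blast
  moreover have "primary_decomposition (mpoly_ring n) I ?A (\<lambda>(j, \<sigma>). Q j \<sigma>)"
    unfolding primary_decomposition_def
  proof (intro conjI)
    have "?A \<subseteq> {1..n} \<times> {\<sigma>. \<sigma> permutes {1..n}}" by blast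
    then show "finite ?A" by (rule finite_subset) (simp add: finite_permutations)
    show "\<forall>a\<in>?A. primary_ideal (mpoly_ring n) (case a of (j, \<sigma>) \<Rightarrow> Q j \<sigma>)"
      using Q primary_order_ge by (auto simp del: One_nat_def)
    show "I = carrier (mpoly_ring n) \<inter> (\<Inter>a\<in>?A. case a of (j, \<sigma>) \<Rightarrow> Q j \<sigma>)"
      using mem zero by blast
  qed
  ultimately show ?thesis unfolding Q_def s_def by blast
qed

end
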